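(* Let $P$ be a finite poset with $k$ connected components, $\mathbb{F}$ a field, $G$ a finite group, and $\mathcal{A}=I(P,\mathbb{F})$ the incidence algebra. Then the number $n_G$ of inequivalent elementary $G$-gradings on $\mathcal{A}$ (i.e. of elementary $G$-gradings up to isomorphism of $G$-graded algebras, equivalently the number of $\sim$-classes in $G_e^P$) is $$n_G=\frac{1}{|G|^k\,|\mathrm{Aut}(P)|}\sum_{(\mathbf{h},\sigma)\in G^k\times\mathrm{Aut}(P)}\bigl|X^{(\mathbf{h},\sigma)}\bigr|,$$ where $X^{(\mathbf{h},\sigma)}=\{\theta\in G_e^P: \mathbf{h}(\theta\sigma)=\theta\}$.
   Context: The incidence algebra $I(P,\mathbb{F})$ of a locally finite (e.g. finite) poset $(P,\preceq)$ is the $\mathbb{F}$-algebra of all functions $f:P\times P\to\mathbb{F}$ with $f(x,y)=0$ whenever $x\not\preceq y$, with pointwise addition and scalar multiplication and product $(f_1f_2)(x,y)=\sum_{x\preceq z\preceq y}f_1(x,z)f_2(z,y)$. $G^P$ is the set of all functions $\theta:P\to G$, $x\mapsto\theta_x$; $G_e^P$ is the set of $\theta\in G^P$ for which $\{\theta_x^{-1}\theta_y: x\preceq y\}$ is finite (so $G_e^P=G^P$ when $P$ or $G$ is finite). For $\theta\in G_e^P$ and $g\in G$, put $\mathcal{A}^\theta(g)=\{f\in\mathcal{A}: f(x,y)=0 \text{ whenever } x\preceq y \text{ and } \theta_x^{-1}\theta_y\neq g\}$; these subspaces form a $G$-grading of $\mathcal{A}$, denoted $\mathcal{A}^\theta$.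 A $G$-grading on $\mathcal{A}$ is elementary if it equals $\mathcal{A}^\theta$ for some $\theta$. An isomorphism of $G$-graded algebras is an $\mathbb{F}$-algebra isomorphism mapping the component of degree $g$ onto the component of degree $g$ for all $g\in G$. Connected components of $P$: $x,y$ are connected if there are $x=x_0,\dots,x_n=y$ in $P$ with consecutive elements comparable. Let $P_1,\dots,P_k$ be the connected components. $G^k$ acts on $G_e^P$ by $(\mathbf{h}\theta)(x)=h_i\theta(x)$ for $x\in P_i$, $\mathbf{h}=(h_1,\dots,h_k)$. For $\sigma\in\mathrm{Aut}(P)$ (order automorphisms of $P$), $(\theta\sigma)(x)=\theta(\sigma^{-1}(x))$. The equivalence relation $\sim$ on $G_e^P$ is: $\theta\sim\mu$ iff $\theta=\mathbf{h}(\mu\sigma)$ for some $\mathbf{h}\in G^k$, $\sigma\in\mathrm{Aut}(P)$. *)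

theory Defs
  imports
    Complex_Main
    "HOL-Library.FuncSet"
    "HOL-Library.Function_Algebras"
    "HOL-Algebra.Group"
    "HOL-Combinatorics.Permutations"
begin

text \<open>
  A poset is a carrier set \<open>P\<close> together with its order relation \<open>r\<close>, in the sense of
  \<^const>\<open>partial_order_on\<close>; in particular \<open>r \<subseteq> P \<times> P\<close>.
\<close>

section \<open>Connected components and automorphisms of a poset\<close>

definition connected_rel :: "'p set \<Rightarrow> 'p rel \<Rightarrow> 'p rel" where
  "connected_rel P r = {(x, y). x \<in> P \<and> y \<in> P \<and> (x, y) \<in> (r \<union> r\<inverse>)\<^sup>*}"

definition component :: "'p set \<Rightarrow> 'p rel \<Rightarrow> 'p \<Rightarrow> 'p set" where
  "component P r x = connected_rel P r `` {x}"

definition components :: "'p set \<Rightarrow> 'p rel \<Rightarrow> 'p set set" where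
  "components P r = P // connected_rel P r"

text \<open>Since \<open>permutes\<close> makes an automorphism the identity outside \<open>P\<close>, different elements of
  the following set differ on \<open>P\<close>.\<close>

definition poset_aut :: "'p set \<Rightarrow> 'p rel \<Rightarrow> ('p \<Rightarrow> 'p) set" where
  "poset_aut P r =
     {\<sigma>. \<sigma> permutes P \<and> (\<forall>x\<in>P. \<forall>y\<in>P. (x, y) \<in> r \<longleftrightarrow> (\<sigma> x, \<sigma> y) \<in> r)}"


section \<open>The incidence algebra\<close>

text \<open>
  Because \<open>r \<subseteq> P \<times> P\<close>, a function on \<open>P \<times> P\<close> vanishing off \<open>r\<close> is the same thing as
  a function on all pairs vanishing off \<open>r\<close>. Addition and zero are the pointwise ones provided by
  \<^theory>\<open>HOL-Library.Function_Algebras\<close>; its pointwise product is not the one of the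
  incidence algebra and is not used.
\<close>

definition incidence_algebra :: "'p rel \<Rightarrow> ('p \<Rightarrow> 'p \<Rightarrow> 'f::field) set" where
  "incidence_algebra r = {f. \<forall>x y. (x, y) \<notin> r \<longrightarrow> f x y = 0}"

definition incidence_scale :: "'f::field \<Rightarrow> ('p \<Rightarrow> 'p \<Rightarrow> 'f) \<Rightarrow> 'p \<Rightarrow> 'p \<Rightarrow> 'f" where
  "incidence_scale c f = (\<lambda>x y. c * f x y)"

definition incidence_mult ::
  "'p rel \<Rightarrow> ('p \<Rightarrow> 'p \<Rightarrow> 'f::field) \<Rightarrow> ('p \<Rightarrow> 'p \<Rightarrow> 'f) \<Rightarrow> 'p \<Rightarrow> 'p \<Rightarrow> 'f" where
  "incidence_mult r f1 f2 = (\<lambda>x y. \<Sum>z | (x, z) \<in> r \<and> (z, y) \<in> r. f1 x z * f2 z y)"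

definition incidence_one :: "'p set \<Rightarrow> 'p \<Rightarrow> 'p \<Rightarrow> 'f::field" where
  "incidence_one P = (\<lambda>x y. if x = y \<and> x \<in> P then 1 else 0)"

global_interpretation incidence: vector_space incidence_scale
  by unfold_locales (auto simp: incidence_scale_def fun_eq_iff algebra_simps)

definition incidence_automorphism ::
  "'p set \<Rightarrow> 'p rel \<Rightarrow> (('p \<Rightarrow> 'p \<Rightarrow> 'f::field) \<Rightarrow> ('p \<Rightarrow> 'p \<Rightarrow> 'f)) \<Rightarrow> bool" where
  "incidence_automorphism P r \<phi> \<longleftrightarrow>
     bij_betw \<phi> (incidence_algebra r) (incidence_algebra r) \<and>
     (\<forall>f1\<in>incidence_algebra r. \<forall>f2\<in>incidence_algebra r. \<phi> (f1 + f2) = \<phi> f1 + \<phi> f2) \<and>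
     (\<forall>c. \<forall>f\<in>incidence_algebra r. \<phi> (incidence_scale c f) = incidence_scale c (\<phi> f)) \<and>
     (\<forall>f1\<in>incidence_algebra r. \<forall>f2\<in>incidence_algebra r.
        \<phi> (incidence_mult r f1 f2) = incidence_mult r (\<phi> f1) (\<phi> f2)) \<and>
     \<phi> (incidence_one P) = incidence_one P"


section \<open>Group gradings\<close>

text \<open>
  A grading assigns a subspace to each element of \<open>carrier G\<close> and is \<^const>\<open>undefined\<close> elsewhere,
  so that equality of gradings is equality of functions. The third condition says that the algebra
  is the direct sum of these subspaces.
\<close>

definition is_grading ::
  "('g, 'm) monoid_scheme \<Rightarrow> 'p rel \<Rightarrow> ('g \<Rightarrow> ('p \<Rightarrow> 'p \<Rightarrow> 'f::field) set) \<Rightarrow> bool" where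
  "is_grading G r \<Gamma> \<longleftrightarrow>
     \<Gamma> \<in> extensional (carrier G) \<and>
     (\<forall>g\<in>carrier G. incidence.subspace (\<Gamma> g) \<and> \<Gamma> g \<subseteq> incidence_algebra r) \<and>
     (\<forall>f\<in>incidence_algebra r. \<exists>!a. a \<in> Pi\<^sub>E (carrier G) \<Gamma> \<and>
        finite {g \<in> carrier G. a g \<noteq> 0} \<and> f = (\<Sum>g | g \<in> carrier G \<and> a g \<noteq> 0. a g)) \<and>
     (\<forall>g\<in>carrier G. \<forall>h\<in>carrier G. \<forall>f1\<in>\<Gamma> g. \<forall>f2\<in>\<Gamma> h.
        incidence_mult r f1 f2 \<in> \<Gamma> (g \<otimes>\<^bsub>G\<^esub> h))"

definition graded_isomorphic ::
  "('g, 'm) monoid_scheme \<Rightarrow> 'p set \<Rightarrow> 'p rel \<Rightarrow>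
   ('g \<Rightarrow> ('p \<Rightarrow> 'p \<Rightarrow> 'f::field) set) \<Rightarrow> ('g \<Rightarrow> ('p \<Rightarrow> 'p \<Rightarrow> 'f) set) \<Rightarrow> bool" where
  "graded_isomorphic G P r \<Gamma> \<Delta> \<longleftrightarrow>
     (\<exists>\<phi>. incidence_automorphism P r \<phi> \<and> (\<forall>g\<in>carrier G. \<phi> ` \<Gamma> g = \<Delta> g))"


section \<open>Elementary gradings\<close>

text \<open>The set \<open>G\<^sub>e\<^sup>P\<close>.\<close>

definition grading_maps :: "('g, 'm) monoid_scheme \<Rightarrow> 'p set \<Rightarrow> 'p rel \<Rightarrow> ('p \<Rightarrow> 'g) set" where
  "grading_maps G P r =
     {\<theta> \<in> P \<rightarrow>\<^sub>E carrier G. finite {inv\<^bsub>G\<^esub> (\<theta> x) \<otimes>\<^bsub>G\<^esub> \<theta> y | x y. (x, y) \<in> r}}"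

text \<open>The family \<open>\<A>\<^sup>\<theta>\<close>.\<close>

definition induced_grading ::
  "('g, 'm) monoid_scheme \<Rightarrow> 'p rel \<Rightarrow> ('p \<Rightarrow> 'g) \<Rightarrow> 'g \<Rightarrow> ('p \<Rightarrow> 'p \<Rightarrow> 'f::field) set" where
  "induced_grading G r \<theta> =
     (\<lambda>g\<in>carrier G. {f \<in> incidence_algebra r.
        \<forall>x y. (x, y) \<in> r \<and> inv\<^bsub>G\<^esub> (\<theta> x) \<otimes>\<^bsub>G\<^esub> \<theta> y \<noteq> g \<longrightarrow> f x y = 0})"

definition elementary_gradings ::
  "('g, 'm) monoid_scheme \<Rightarrow> 'p set \<Rightarrow> 'p rel \<Rightarrow> ('g \<Rightarrow> ('p \<Rightarrow> 'p \<Rightarrow> 'f::field) set) set" where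
  "elementary_gradings G P r =
     {\<Gamma>. is_grading G r \<Gamma> \<and> (\<exists>\<theta>\<in>grading_maps G P r. \<Gamma> = induced_grading G r \<theta>)}"

definition elementary_iso_rel ::
  "('g, 'm) monoid_scheme \<Rightarrow> 'p set \<Rightarrow> 'p rel \<Rightarrow> ('g \<Rightarrow> ('p \<Rightarrow> 'p \<Rightarrow> 'f::field) set) rel" where
  "elementary_iso_rel G P r =
     {(\<Gamma>, \<Delta>). \<Gamma> \<in> elementary_gradings G P r \<and> \<Delta> \<in> elementary_gradings G P r \<and>
        graded_isomorphic G P r \<Gamma> \<Delta>}"


section \<open>The actions of \<open>G\<^sup>k\<close> and of the automorphism group\<close>

text \<open>The factors of \<open>G\<^sup>k\<close> are indexed by the \<open>k\<close> components themselves instead of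
  by a numbering of them.\<close>

definition component_tuples :: "('g, 'm) monoid_scheme \<Rightarrow> 'p set \<Rightarrow> 'p rel \<Rightarrow> ('p set \<Rightarrow> 'g) set" where
  "component_tuples G P r = components P r \<rightarrow>\<^sub>E carrier G"

definition tuple_act ::
  "('g, 'm) monoid_scheme \<Rightarrow> 'p set \<Rightarrow> 'p rel \<Rightarrow> ('p set \<Rightarrow> 'g) \<Rightarrow> ('p \<Rightarrow> 'g) \<Rightarrow> 'p \<Rightarrow> 'g" where
  "tuple_act G P r h \<theta> = (\<lambda>x\<in>P. h (component P r x) \<otimes>\<^bsub>G\<^esub> \<theta> x)"

definition aut_act :: "('p \<Rightarrow> 'g) \<Rightarrow> ('p \<Rightarrow> 'p) \<Rightarrow> 'p \<Rightarrow> 'g" where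
  "aut_act \<theta> \<sigma> = (\<lambda>x. \<theta> (inv_into UNIV \<sigma> x))"

definition grading_map_rel :: "('g, 'm) monoid_scheme \<Rightarrow> 'p set \<Rightarrow> 'p rel \<Rightarrow> ('p \<Rightarrow> 'g) rel" where
  "grading_map_rel G P r =
     {(\<theta>, \<mu>). \<theta> \<in> grading_maps G P r \<and> \<mu> \<in> grading_maps G P r \<and>
        (\<exists>h\<in>component_tuples G P r. \<exists>\<sigma>\<in>poset_aut P r. \<theta> = tuple_act G P r h (aut_act \<mu> \<sigma>))}"

definition fixed_maps ::
  "('g, 'm) monoid_scheme \<Rightarrow> 'p set \<Rightarrow> 'p rel \<Rightarrow> ('p set \<Rightarrow> 'g) \<Rightarrow> ('p \<Rightarrow> 'p) \<Rightarrow> ('p \<Rightarrow> 'g) set" where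
  "fixed_maps G P r h \<sigma> = {\<theta> \<in> grading_maps G P r. tuple_act G P r h (aut_act \<theta> \<sigma>) = \<theta>}"

end

theory Submission
  imports Defs "HOL-Algebra.Group_Action"
begin

text \<open>
  The count is Burnside's lemma for the semidirect product of \<open>G\<^sup>k\<close> and the automorphism group of
  \<open>P\<close> acting on \<open>G\<^sub>e\<^sup>P\<close>, once \<open>\<A>\<^sup>\<theta> \<cong> \<A>\<^sup>\<mu>\<close> is known to be equivalent to \<open>\<theta> \<sim> \<mu>\<close>. For the nontrivial
  implication, let \<open>\<phi>\<close> be a graded isomorphism. For each \<open>x\<close> the idempotent \<open>\<phi> e\<^sub>x\<^sub>x\<close> has exactly one
  nonzero diagonal entry, at \<open>\<sigma> x\<close> say. If \<open>x \<preceq> y\<close> then \<open>w = \<phi> e\<^sub>x\<^sub>y\<close> is nonzero and is fixed by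
  multiplication with \<open>\<phi> e\<^sub>x\<^sub>x\<close> on the left and \<open>\<phi> e\<^sub>y\<^sub>y\<close> on the right. A shortest interval supporting
  \<open>w\<close> must then be \<open>[\<sigma> x, \<sigma> y]\<close>, so \<open>\<sigma>\<close> is an automorphism of \<open>P\<close> and, comparing degrees,
  \<open>\<theta>\<^sub>x\<inverse> \<theta>\<^sub>y = \<mu>\<^bsub>\<sigma> x\<^esub>\<inverse> \<mu>\<^bsub>\<sigma> y\<^esub>\<close>. Hence \<open>\<theta>\<^sub>x \<mu>\<^bsub>\<sigma> x\<^esub>\<inverse>\<close> is constant on connected components.
\<close>

text \<open>\<open>F\<close> may identify points, but only within one \<open>R\<close>-class:
  \<open>F x = F y\<close> gives \<open>(F x, F y) \<in> S\<close> by reflexivity of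
  \<open>R\<close>, hence \<open>(x, y) \<in> R\<close>. So taking images is a bijection between the
  classes. It is applied to the map sending \<open>\<theta>\<close> to the grading it
  induces.\<close>

lemma card_quotient_image:
  assumes R: "equiv X R" and S: "S \<subseteq> F ` X \<times> F ` X"
    and iff: "\<And>x y. x \<in> X \<Longrightarrow> y \<in> X \<Longrightarrow> (F x, F y) \<in> S \<longleftrightarrow> (x, y) \<in> R"
  shows "card ((F ` X) // S) = card (X // R)"
proof -
  have class_image: "S `` {F x} = F ` (R `` {x})" if "x \<in> X" for x
  proof (intro equalityI subsetI)
    fix b assume b: "b \<in> S `` {F x}"
    then obtain y where "y \<in> X" "b = F y"
      using S by auto
    then show "b \<in> F ` (R `` {x})"
      using b iff[OF that] by auto
  next
    fix b assume "b \<in> F ` (R `` {x})"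
    then obtain y where "(x, y) \<in> R" "b = F y"
      by auto
    then show "b \<in> S `` {F x}"
      using iff[OF that] equiv_type[OF R] by auto
  qed
  then have "(F ` X) // S = (`) F ` (X // R)"
    by (auto simp: quotient_def)
  moreover have "inj_on ((`) F) (X // R)"
  proof (rule inj_onI)
    fix A B assume "A \<in> X // R" "B \<in> X // R" and eq: "F ` A = F ` B"
    then obtain x y where x: "x \<in> X" "A = R `` {x}" and y: "y \<in> X" "B = R `` {y}"
      by (auto simp: quotient_def)
    then have "F y \<in> F ` A"
      using eq equiv_class_self[OF R] by blast
    then have "(F x, F y) \<in> S"
      using class_image x by blast
    then have "(x, y) \<in> R"
      using iff x y by blast
    then show "A = B"
      using equiv_class_eq[OF R] x y by simp
  qed
  ultimately show ?thesis
    by (simp add: card_image)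
qed

section \<open>Finite posets\<close>

locale finite_poset =
  fixes P :: "'p set" and r :: "'p rel"
  assumes finite_carrier: "finite P" and partial_order: "partial_order_on P r"
begin

lemma rel_carrier: "(x, y) \<in> r \<Longrightarrow> x \<in> P \<and> y \<in> P"
  using partial_order by (auto simp: partial_order_on_def preorder_on_def)

lemma rel_refl: "x \<in> P \<Longrightarrow> (x, x) \<in> r"
  using partial_order by (auto simp: partial_order_on_def preorder_on_def refl_on_def)

lemma rel_trans: "(x, y) \<in> r \<Longrightarrow> (y, z) \<in> r \<Longrightarrow> (x, z) \<in> r"
  using partial_order by (auto simp: partial_order_on_def preorder_on_def dest: transD)

lemma rel_antisym: "(x, y) \<in> r \<Longrightarrow> (y, x) \<in> r \<Longrightarrow> x = y"
  using partial_order by (auto simp: partial_order_on_def dest: antisymD)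

lemma finite_rel: "finite r"
  using finite_carrier rel_carrier by (auto intro: finite_subset[of r "P \<times> P"])

section \<open>Connected components\<close>

lemma equiv_connected_rel: "equiv P (connected_rel P r)"
proof (rule equivI)
  show "connected_rel P r \<subseteq> P \<times> P"
    by (auto simp: connected_rel_def)
  show "refl_on P (connected_rel P r)"
    by (auto simp: connected_rel_def refl_on_def)
  have "sym (r \<union> r\<inverse>)"
    by (auto simp: sym_def)
  then show "sym (connected_rel P r)"
    using sym_rtrancl[of "r \<union> r\<inverse>"] by (auto simp: connected_rel_def intro!: symI dest: symD)
  show "trans (connected_rel P r)"
    unfolding connected_rel_def by (rule transI) auto
qed

lemma component_in_components: "x \<in> P \<Longrightarrow> component P r x \<in> components P r"
  by (auto simp: component_def components_def quotient_def)

lemma componentsE: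
  assumes "C \<in> components P r"
  obtains x where "x \<in> P" "C = component P r x"
  using assms by (auto simp: component_def components_def quotient_def)

lemma component_eq_iff:
  "x \<in> P \<Longrightarrow> y \<in> P \<Longrightarrow> component P r x = component P r y \<longleftrightarrow> (x, y) \<in> (r \<union> r\<inverse>)\<^sup>*"
  unfolding component_def using eq_equiv_class_iff[OF equiv_connected_rel, of x y]
  by (auto simp: connected_rel_def)

lemma self_in_component: "x \<in> P \<Longrightarrow> x \<in> component P r x"
  by (auto simp: component_def connected_rel_def)

lemma component_subset: "component P r x \<subseteq> P"
  by (auto simp: component_def connected_rel_def)

lemma component_rel: "(x, y) \<in> r \<Longrightarrow> component P r x = component P r y"
  using rel_carrier by (subst component_eq_iff) auto

lemma finite_components: "finite (components P r)"
  unfolding components_def using equiv_connected_rel finite_carrier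
  by (auto simp: quotient_def)

section \<open>Order automorphisms and their effect on components\<close>

lemma poset_aut_permutes: "\<sigma> \<in> poset_aut P r \<Longrightarrow> \<sigma> permutes P"
  by (simp add: poset_aut_def)

text \<open>Valid for all \<open>x\<close> and \<open>y\<close>: if one of them lies outside
  \<open>P\<close>, both sides are false, since \<open>r\<close> lives on \<open>P\<close> and
  \<open>\<sigma>\<close> maps exactly \<open>P\<close> into \<open>P\<close>.\<close>

lemma poset_aut_rel_iff: "\<sigma> \<in> poset_aut P r \<Longrightarrow> (\<sigma> x, \<sigma> y) \<in> r \<longleftrightarrow> (x, y) \<in> r"
  using rel_carrier permutes_in_image[of \<sigma> P] unfolding poset_aut_def by blast

lemma id_poset_aut: "id \<in> poset_aut P r"
  by (simp add: poset_aut_def permutes_id)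

lemma comp_poset_aut:
  "\<sigma> \<in> poset_aut P r \<Longrightarrow> \<tau> \<in> poset_aut P r \<Longrightarrow> \<sigma> \<circ> \<tau> \<in> poset_aut P r"
  using poset_aut_rel_iff poset_aut_permutes permutes_compose[of \<tau> P \<sigma>]
  \<comment> \<open>The definition is unfolded for the composition alone, so that membership of the
    two factors stays available to the lemmas about \<open>poset_aut\<close>.\<close>
  unfolding poset_aut_def[of P r, THEN eqset_imp_iff, of "\<sigma> \<circ> \<tau>"] by simp

lemma inv_poset_aut:
  assumes "\<sigma> \<in> poset_aut P r"
  shows "inv_into UNIV \<sigma> \<in> poset_aut P r"
proof -
  note perm = poset_aut_permutes[OF assms]
  have "(inv_into UNIV \<sigma> x, inv_into UNIV \<sigma> y) \<in> r \<longleftrightarrow> (x, y) \<in> r" for x y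
    using poset_aut_rel_iff[OF assms, of "inv_into UNIV \<sigma> x" "inv_into UNIV \<sigma> y"] permutes_inverses[OF perm] by simp
  then show ?thesis
    using permutes_inv[OF perm] by (simp add: poset_aut_def)
qed

lemma finite_poset_aut: "finite (poset_aut P r)"
  using finite_permutations[OF finite_carrier] by (rule finite_subset[rotated]) (auto simp: poset_aut_def)

text \<open>A bijection of a finite poset that preserves the order also reflects it, because it acts
  injectively on the finite set \<^term>\<open>r\<close>.\<close>

lemma order_preserving_permutes_poset_aut:
  assumes perm: "\<sigma> permutes P" and mono: "\<And>x y. (x, y) \<in> r \<Longrightarrow> (\<sigma> x, \<sigma> y) \<in> r"
  shows "\<sigma> \<in> poset_aut P r"
proof -
  have inj: "inj (map_prod \<sigma> \<sigma>)"
    by (intro prod.inj_map permutes_inj[OF perm])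
  have "map_prod \<sigma> \<sigma> ` r = r"
    using finite_rel mono inj_on_subset[OF inj subset_UNIV] by (intro endo_inj_surj) auto
  then have "(\<sigma> x, \<sigma> y) \<in> r \<Longrightarrow> (x, y) \<in> r" for x y
    using inj by (metis inj_image_mem_iff map_prod_simp)
  then show ?thesis
    using perm mono unfolding poset_aut_def by blast
qed

text \<open>A chain of comparable elements is carried to such a chain. The converse is the same fact
  for the inverse automorphism, which is why \<open>imp\<close> is proved for an arbitrary
  \<open>\<tau>\<close>.\<close>

lemma poset_aut_connected_iff:
  assumes "\<sigma> \<in> poset_aut P r"
  shows "(\<sigma> x, \<sigma> y) \<in> (r \<union> r\<inverse>)\<^sup>* \<longleftrightarrow> (x, y) \<in> (r \<union> r\<inverse>)\<^sup>*"
proof -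
  have imp: "(\<tau> x, \<tau> y) \<in> (r \<union> r\<inverse>)\<^sup>*" if "\<tau> \<in> poset_aut P r" "(x, y) \<in> (r \<union> r\<inverse>)\<^sup>*" for \<tau> x y
    using that(2)
  proof (induction rule: rtrancl_induct)
    case (step y z)
    then show ?case
      using poset_aut_rel_iff[OF that(1)] by (auto intro: rtrancl.rtrancl_into_rtrancl)
  qed simp
  show ?thesis
    using imp[OF assms] imp[OF inv_poset_aut[OF assms], of "\<sigma> x" "\<sigma> y"]
      permutes_inverses[OF poset_aut_permutes[OF assms]] by auto
qed

text \<open>Automorphisms preserve \<open>P\<close> and connectedness, so they permute the
  components. The preimage form matches the way the product of \<open>relabelling_group\<close>
  reads its second tuple.\<close>

lemma component_inv:
  assumes "\<sigma> \<in> poset_aut P r" "x \<in> P"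
  shows "component P r (inv_into UNIV \<sigma> x) = \<sigma> -` component P r x"
proof -
  note perm = poset_aut_permutes[OF assms(1)]
  show ?thesis
    using poset_aut_connected_iff[OF assms(1), of "inv_into UNIV \<sigma> x"] permutes_in_image[OF perm]
      permutes_in_image[OF permutes_inv[OF perm]] permutes_inverses[OF perm] assms(2)
    by (auto simp: component_def connected_rel_def)
qed

lemma vimage_in_components:
  assumes "\<sigma> \<in> poset_aut P r" "C \<in> components P r"
  shows "\<sigma> -` C \<in> components P r"
  using assms(2)
proof (rule componentsE)
  fix x assume "x \<in> P" "C = component P r x"
  then show ?thesis
    using component_inv[OF assms(1)] component_in_components
      permutes_in_image[OF permutes_inv[OF poset_aut_permutes[OF assms(1)]]] by metis
qed

end

section \<open>The action of \<open>G\<^sup>k \<rtimes> Aut(P)\<close>\<close>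

text \<open>Each \<open>act g\<close> is bijective on \<open>E\<close> because the action of the
  inverse of \<open>g\<close> undoes it. The restriction to \<open>E\<close> is there because
  \<open>BijGroup E\<close> consists of extensional functions.\<close>

lemma (in group) group_actionI:
  assumes closed: "\<And>g x. g \<in> carrier G \<Longrightarrow> x \<in> E \<Longrightarrow> act g x \<in> E"
    and one: "\<And>x. x \<in> E \<Longrightarrow> act \<one> x = x"
    and mult: "\<And>g h x. g \<in> carrier G \<Longrightarrow> h \<in> carrier G \<Longrightarrow> x \<in> E \<Longrightarrow>
      act (g \<otimes> h) x = act g (act h x)"
  shows "group_action G E (\<lambda>g. restrict (act g) E)"
proof -
  have bij: "restrict (act g) E \<in> Bij E" if "g \<in> carrier G" for g
  proof -
    have "bij_betw (act g) E E"
      using that closed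
      by (intro bij_betw_byWitness[where f' = "act (inv\<^bsub>G\<^esub> g)"])
        (auto simp flip: mult simp: one)
    then show ?thesis
      by (simp add: Bij_def)
  qed
  have "(\<lambda>g. restrict (act g) E) \<in> hom G (BijGroup E)"
    using bij closed by (auto simp: hom_def BijGroup_def mult compose_def fun_eq_iff)
  then show ?thesis
    by (simp add: group_action_def group_hom_def group_hom_axioms_def group_BijGroup is_group)
qed

locale finite_poset_group = finite_poset P r + group G
  for P :: "'p set" and r :: "'p rel" and G :: "('g, 'm) monoid_scheme" (structure) +
  assumes finite_group: "finite (carrier G)"
begin

text \<open>Applying \<open>(h, \<sigma>)\<close> after \<open>(h', \<sigma>')\<close> multiplies the value at \<open>x\<close> by the entries of \<open>h\<close> at the
  component of \<open>x\<close> and of \<open>h'\<close> at that of \<open>\<sigma>\<inverse> x\<close>, whence the semidirect product. The preimage under \<open>\<sigma>\<close>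
  avoids the inverse.\<close>

definition relabelling_group :: "(('p set \<Rightarrow> 'g) \<times> ('p \<Rightarrow> 'p)) monoid" where
  "relabelling_group =
    \<lparr>carrier = component_tuples G P r \<times> poset_aut P r,
     monoid.mult = (\<lambda>(h, \<sigma>) (h', \<sigma>'). (\<lambda>C\<in>components P r. h C \<otimes> h' (\<sigma> -` C), \<sigma> \<circ> \<sigma>')),
     one = (\<lambda>C\<in>components P r. \<one>, id)\<rparr>"

definition relabel :: "('p set \<Rightarrow> 'g) \<times> ('p \<Rightarrow> 'p) \<Rightarrow> ('p \<Rightarrow> 'g) \<Rightarrow> 'p \<Rightarrow> 'g" where
  "relabel = (\<lambda>(h, \<sigma>) \<theta>. tuple_act G P r h (aut_act \<theta> \<sigma>))"

lemma component_tuples_closed: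
  "h \<in> component_tuples G P r \<Longrightarrow> C \<in> components P r \<Longrightarrow> h C \<in> carrier G"
  by (auto simp: component_tuples_def)

lemma restrict_component_tuples:
  "restrict f (components P r) \<in> component_tuples G P r \<longleftrightarrow> (\<forall>C\<in>components P r. f C \<in> carrier G)"
  by (auto simp: component_tuples_def restrict_PiE_iff)

lemma carrier_relabelling_group:
  "carrier relabelling_group = component_tuples G P r \<times> poset_aut P r"
  by (simp add: relabelling_group_def)

lemma mult_relabelling_group:
  "(h, \<sigma>) \<otimes>\<^bsub>relabelling_group\<^esub> (h', \<sigma>') =
    (\<lambda>C\<in>components P r. h C \<otimes> h' (\<sigma> -` C), \<sigma> \<circ> \<sigma>')"
  by (simp add: relabelling_group_def)

lemma one_relabelling_group: "\<one>\<^bsub>relabelling_group\<^esub> = (\<lambda>C\<in>components P r. \<one>, id)"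
  by (simp add: relabelling_group_def)

lemma group_relabelling_group: "group relabelling_group"
proof (rule groupI, unfold carrier_relabelling_group)
  fix x y assume "x \<in> component_tuples G P r \<times> poset_aut P r"
    "y \<in> component_tuples G P r \<times> poset_aut P r"
  then show "x \<otimes>\<^bsub>relabelling_group\<^esub> y \<in> component_tuples G P r \<times> poset_aut P r"
    by (cases x; cases y)
      (simp add: mult_relabelling_group restrict_component_tuples component_tuples_closed
        vimage_in_components comp_poset_aut)
next
  show "\<one>\<^bsub>relabelling_group\<^esub> \<in> component_tuples G P r \<times> poset_aut P r"
    by (simp add: one_relabelling_group restrict_component_tuples id_poset_aut)
next
  fix x y z
  assume "x \<in> component_tuples G P r \<times> poset_aut P r"
    "y \<in> component_tuples G P r \<times> poset_aut P r" "z \<in> component_tuples G P r \<times> poset_aut P r"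
  then show "x \<otimes>\<^bsub>relabelling_group\<^esub> y \<otimes>\<^bsub>relabelling_group\<^esub> z =
      x \<otimes>\<^bsub>relabelling_group\<^esub> (y \<otimes>\<^bsub>relabelling_group\<^esub> z)"
    by (cases x; cases y; cases z)
      (simp add: mult_relabelling_group vimage_in_components component_tuples_closed m_assoc
        vimage_comp comp_assoc comp_poset_aut cong: restrict_cong)
next
  fix x assume "x \<in> component_tuples G P r \<times> poset_aut P r"
  then obtain h \<sigma> where x: "x = (h, \<sigma>)" "h \<in> component_tuples G P r"
    by auto
  have "(\<lambda>C\<in>components P r. \<one> \<otimes> h C) = h"
    using x(2) by (intro extensionalityI[of _ "components P r"])
      (auto simp: component_tuples_closed component_tuples_def PiE_def)
  then show "\<one>\<^bsub>relabelling_group\<^esub> \<otimes>\<^bsub>relabelling_group\<^esub> x = x"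
    by (simp add: x(1) one_relabelling_group mult_relabelling_group cong: restrict_cong)
next
  fix x assume "x \<in> component_tuples G P r \<times> poset_aut P r"
  then obtain h \<sigma> where x: "x = (h, \<sigma>)" "h \<in> component_tuples G P r" "\<sigma> \<in> poset_aut P r"
    by auto
  \<comment> \<open>At \<open>C\<close>, the tuple of the product of \<open>y\<close> and
    \<open>x\<close> is the entry of \<open>y\<close> at \<open>C\<close> times \<open>h\<close> at
    the preimage of \<open>C\<close> under the permutation of \<open>y\<close>. Once that
    permutation is the inverse of \<open>\<sigma>\<close>, the entry of \<open>y\<close> is
    forced.\<close>
  define y where "y = (\<lambda>C\<in>components P r. inv\<^bsub>G\<^esub> (h (inv_into UNIV \<sigma> -` C)), inv_into UNIV \<sigma>)"
  note closed = component_tuples_closed[OF x(2) vimage_in_components[OF inv_poset_aut[OF x(3)]]]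
  have "y \<in> component_tuples G P r \<times> poset_aut P r"
    by (simp add: y_def restrict_component_tuples closed inv_poset_aut[OF x(3)])
  moreover have "y \<otimes>\<^bsub>relabelling_group\<^esub> x = \<one>\<^bsub>relabelling_group\<^esub>"
    using permutes_inv_o[OF poset_aut_permutes[OF x(3)]]
    by (simp add: y_def x(1) mult_relabelling_group one_relabelling_group closed
        cong: restrict_cong)
  ultimately show "\<exists>y\<in>component_tuples G P r \<times> poset_aut P r.
      y \<otimes>\<^bsub>relabelling_group\<^esub> x = \<one>\<^bsub>relabelling_group\<^esub>"
    by blast
qed

text \<open>The degrees \<open>inv (\<theta> x) \<otimes> \<theta> y\<close> are the image of the
  finite relation \<open>r\<close>, hence a finite set for every \<open>\<theta>\<close>.\<close>

lemma grading_maps_eq: "grading_maps G P r = P \<rightarrow>\<^sub>E carrier G"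
proof -
  have "finite {inv (\<theta> x) \<otimes> \<theta> y | x y. (x, y) \<in> r}" for \<theta> :: "'p \<Rightarrow> 'g"
  proof -
    have "{inv (\<theta> x) \<otimes> \<theta> y | x y. (x, y) \<in> r} = (\<lambda>(x, y). inv (\<theta> x) \<otimes> \<theta> y) ` r"
      by auto
    then show ?thesis
      using finite_rel by simp
  qed
  then show ?thesis
    by (auto simp: grading_maps_def)
qed

lemma finite_grading_maps: "finite (grading_maps G P r)"
  by (simp add: grading_maps_eq finite_PiE finite_carrier finite_group)

lemma grading_map_closed: "\<theta> \<in> grading_maps G P r \<Longrightarrow> x \<in> P \<Longrightarrow> \<theta> x \<in> carrier G"
  by (auto simp: grading_maps_eq)

section \<open>The action on grading maps\<close>

lemma relabel_apply:
  "x \<in> P \<Longrightarrow> relabel (h, \<sigma>) \<theta> x = h (component P r x) \<otimes> \<theta> (inv_into UNIV \<sigma> x)"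
  by (simp add: relabel_def tuple_act_def aut_act_def)

lemma inv_poset_aut_closed: "\<sigma> \<in> poset_aut P r \<Longrightarrow> x \<in> P \<Longrightarrow> inv_into UNIV \<sigma> x \<in> P"
  using permutes_in_image[OF poset_aut_permutes[OF inv_poset_aut]] by simp

lemma relabel_closed:
  assumes "h \<in> component_tuples G P r" "\<sigma> \<in> poset_aut P r" "\<theta> \<in> grading_maps G P r"
  shows "relabel (h, \<sigma>) \<theta> \<in> grading_maps G P r"
  unfolding grading_maps_eq
proof (rule PiE_I)
  fix x assume "x \<in> P"
  then show "relabel (h, \<sigma>) \<theta> x \<in> carrier G"
    using assms by (simp add: relabel_apply component_tuples_closed component_in_components
        inv_poset_aut_closed grading_map_closed)
qed (simp add: relabel_def tuple_act_def)

lemma grading_map_eqI: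
  assumes "\<theta> \<in> grading_maps G P r" "\<mu> \<in> grading_maps G P r" "\<And>x. x \<in> P \<Longrightarrow> \<theta> x = \<mu> x"
  shows "\<theta> = \<mu>"
  using assms by (auto simp: grading_maps_eq intro: PiE_ext)

lemma group_action_relabel:
  "group_action relabelling_group (grading_maps G P r)
    (\<lambda>k. restrict (relabel k) (grading_maps G P r))"
proof (rule group.group_actionI[OF group_relabelling_group])
  fix k \<theta> assume "k \<in> carrier relabelling_group" "\<theta> \<in> grading_maps G P r"
  then show "relabel k \<theta> \<in> grading_maps G P r"
    by (auto simp: relabelling_group_def relabel_closed)
next
  fix \<theta> assume \<theta>: "\<theta> \<in> grading_maps G P r"
  have "(\<lambda>C\<in>components P r. \<one>) \<in> component_tuples G P r"
    by (auto simp: component_tuples_def)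
  with \<theta> show "relabel \<one>\<^bsub>relabelling_group\<^esub> \<theta> = \<theta>"
    by (intro grading_map_eqI)
      (auto simp: relabelling_group_def relabel_closed id_poset_aut relabel_apply
        component_in_components grading_map_closed)
next
  fix k l \<theta>
  assume k: "k \<in> carrier relabelling_group" and l: "l \<in> carrier relabelling_group"
    and \<theta>: "\<theta> \<in> grading_maps G P r"
  obtain h \<sigma> where k': "k = (h, \<sigma>)" "h \<in> component_tuples G P r" "\<sigma> \<in> poset_aut P r"
    using k by (auto simp: relabelling_group_def)
  obtain h' \<sigma>' where l': "l = (h', \<sigma>')" "h' \<in> component_tuples G P r" "\<sigma>' \<in> poset_aut P r"
    using l by (auto simp: relabelling_group_def)
  have "k \<otimes>\<^bsub>relabelling_group\<^esub> l \<in> carrier relabelling_group"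
    using group_relabelling_group k l by (simp add: group.is_monoid monoid.m_closed)
  moreover have kl: "k \<otimes>\<^bsub>relabelling_group\<^esub> l =
      (\<lambda>C\<in>components P r. h C \<otimes> h' (\<sigma> -` C), \<sigma> \<circ> \<sigma>')"
    by (simp add: k' l' relabelling_group_def)
  ultimately have closed: "relabel (k \<otimes>\<^bsub>relabelling_group\<^esub> l) \<theta> \<in> grading_maps G P r"
    using \<theta> by (simp add: relabelling_group_def relabel_closed)
  have inv: "inv_into UNIV (\<sigma> \<circ> \<sigma>') = inv_into UNIV \<sigma>' \<circ> inv_into UNIV \<sigma>"
    using k'(3) l'(3) by (intro o_inv_distrib permutes_bij[OF poset_aut_permutes])
  show "relabel (k \<otimes>\<^bsub>relabelling_group\<^esub> l) \<theta> = relabel k (relabel l \<theta>)"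
  proof (rule grading_map_eqI[OF closed])
    show "relabel k (relabel l \<theta>) \<in> grading_maps G P r"
      using k' l' \<theta> by (simp add: relabel_closed)
    fix x assume x: "x \<in> P"
    then have "inv_into UNIV \<sigma> x \<in> P" "inv_into UNIV \<sigma>' (inv_into UNIV \<sigma> x) \<in> P"
      using k' l' by (simp_all add: inv_poset_aut_closed)
    \<comment> \<open>Read backwards, \<open>component_inv\<close> turns the preimage of the
      component of \<open>x\<close> into the component of \<open>inv_into UNIV \<sigma> x\<close>,
      where the right-hand side evaluates \<open>h'\<close>.\<close>
    with x show "relabel (k \<otimes>\<^bsub>relabelling_group\<^esub> l) \<theta> x = relabel k (relabel l \<theta>) x"
      unfolding kl using k' l' \<theta>
      by (simp add: relabel_apply inv component_in_components m_assoc
          component_tuples_closed grading_map_closed component_inv[symmetric])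
  qed
qed

section \<open>Equivalence classes as orbits, and Burnside's lemma\<close>

lemma grading_map_rel_iff:
  "(\<theta>, \<mu>) \<in> grading_map_rel G P r \<longleftrightarrow> \<theta> \<in> grading_maps G P r \<and> \<mu> \<in> grading_maps G P r \<and>
    \<theta> \<in> orbit relabelling_group (\<lambda>k. restrict (relabel k) (grading_maps G P r)) \<mu>"
  by (auto simp: grading_map_rel_def orbit_def relabelling_group_def relabel_def)

lemma equiv_grading_map_rel: "equiv (grading_maps G P r) (grading_map_rel G P r)"
proof -
  interpret act: group_action relabelling_group "grading_maps G P r"
    "\<lambda>k. restrict (relabel k) (grading_maps G P r)"
    by (rule group_action_relabel)
  show ?thesis
  proof (rule equivI)
    show "grading_map_rel G P r \<subseteq> grading_maps G P r \<times> grading_maps G P r"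
      by (auto simp: grading_map_rel_def)
    show "refl_on (grading_maps G P r) (grading_map_rel G P r)"
      by (intro refl_onI) (simp add: grading_map_rel_iff act.orbit_refl)
    show "sym (grading_map_rel G P r)"
      by (rule symI) (metis grading_map_rel_iff act.orbit_sym)
    show "trans (grading_map_rel G P r)"
      by (rule transI) (metis grading_map_rel_iff act.orbit_trans)
  qed
qed

text \<open>Burnside's lemma for \<open>relabelling_group\<close>: the classes are its orbits, its
  order is the product in parentheses, and the points fixed by \<open>(h, \<sigma>)\<close> form
  \<open>fixed_maps G P r h \<sigma>\<close>. The multiplicative form keeps the identity in the
  natural numbers.\<close>

lemma card_classes_mult_order:
  "card (grading_maps G P r // grading_map_rel G P r) *
    (card (carrier G) ^ card (components P r) * card (poset_aut P r)) =
   (\<Sum>(h, \<sigma>) \<in> component_tuples G P r \<times> poset_aut P r. card (fixed_maps G P r h \<sigma>))"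
proof -
  let ?\<phi> = "\<lambda>k. restrict (relabel k) (grading_maps G P r)"
  interpret act: group_action relabelling_group "grading_maps G P r" ?\<phi>
    by (rule group_action_relabel)
  \<comment> \<open>A class collects second components, whereas \<open>grading_map_rel\<close>
    places the first component in the orbit of the second; symmetry of orbits bridges the
    two.\<close>
  have "grading_map_rel G P r `` {\<theta>} = orbit relabelling_group ?\<phi> \<theta>"
    if "\<theta> \<in> grading_maps G P r" for \<theta>
  proof -
    have "(\<theta>, \<mu>) \<in> grading_map_rel G P r \<longleftrightarrow> \<mu> \<in> orbit relabelling_group ?\<phi> \<theta>" for \<mu>
    proof -
      have "\<mu> \<in> orbit relabelling_group ?\<phi> \<theta> \<Longrightarrow> \<mu> \<in> grading_maps G P r"
        using that act.element_image by (auto simp: orbit_def)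
      then show ?thesis
        using that act.orbit_sym grading_map_rel_iff by metis
    qed
    then show ?thesis
      by blast
  qed
  then have "grading_maps G P r // grading_map_rel G P r =
      orbits relabelling_group (grading_maps G P r) ?\<phi>"
    by (auto simp: quotient_def orbits_def)
  moreover have "carrier relabelling_group = component_tuples G P r \<times> poset_aut P r"
    by (simp add: relabelling_group_def)
  moreover have "finite (component_tuples G P r)"
    "card (component_tuples G P r) = card (carrier G) ^ card (components P r)"
    by (simp_all add: component_tuples_def finite_PiE card_PiE finite_components finite_group)
  moreover have "invariants (grading_maps G P r) ?\<phi> k = fixed_maps G P r (fst k) (snd k)" for k
    by (cases k) (auto simp: invariants_def fixed_maps_def relabel_def)
  ultimately show ?thesis
    using act.burnside finite_poset_aut finite_grading_maps
    by (simp add: order_def card_cartesian_product case_prod_beta')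
qed

end

section \<open>Automorphisms of the incidence algebra\<close>

lemma sum_fun_apply2: "(\<Sum>i\<in>I. f i) x y = (\<Sum>i\<in>I. f i x y)"
  for f :: "'i \<Rightarrow> 'p \<Rightarrow> 'q \<Rightarrow> 'b::comm_monoid_add"
  by (induction I rule: infinite_finite_induct) auto

section \<open>Matrix units and products\<close>

definition matrix_unit :: "'p \<Rightarrow> 'p \<Rightarrow> 'p \<Rightarrow> 'p \<Rightarrow> 'f::field" where
  "matrix_unit x y = (\<lambda>a b. if a = x \<and> b = y then 1 else 0)"

lemma matrix_unit_in_algebra: "(x, y) \<in> r \<Longrightarrow> matrix_unit x y \<in> incidence_algebra r"
  by (auto simp: matrix_unit_def incidence_algebra_def)

lemma matrix_unit_nonzero: "matrix_unit x y \<noteq> 0"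
  by (auto simp: matrix_unit_def fun_eq_iff)

lemma incidence_algebraD: "f \<in> incidence_algebra r \<Longrightarrow> f x y \<noteq> 0 \<Longrightarrow> (x, y) \<in> r"
  by (auto simp: incidence_algebra_def)

text \<open>Pulling back along \<open>\<sigma>\<close> keeps the inverse permutation out of the
  formula; for a permutation, the matrix unit at \<open>(\<sigma> x, \<sigma> y)\<close> goes to the
  one at \<open>(x, y)\<close>. These maps realise equivalences of grading maps as graded
  isomorphisms.\<close>

definition transport :: "('p \<Rightarrow> 'p) \<Rightarrow> ('p \<Rightarrow> 'p \<Rightarrow> 'f::field) \<Rightarrow> 'p \<Rightarrow> 'p \<Rightarrow> 'f" where
  "transport \<sigma> f = (\<lambda>x y. f (\<sigma> x) (\<sigma> y))"

context finite_poset
begin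

lemma finite_interval: "finite {z. (x, z) \<in> r \<and> (z, y) \<in> r}"
  using finite_carrier rel_carrier by (auto intro: finite_subset[of _ P])

lemma matrix_unit_mult:
  assumes "(x, y) \<in> r" "(y', z) \<in> r"
  shows "incidence_mult r (matrix_unit x y) (matrix_unit y' z) =
    (if y = y' then matrix_unit x z else (0 :: 'p \<Rightarrow> 'p \<Rightarrow> 'f::field))"
proof (intro ext)
  fix a b
  have "incidence_mult r (matrix_unit x y) (matrix_unit y' z) a b =
      (\<Sum>w | (a, w) \<in> r \<and> (w, b) \<in> r. if w = y then if a = x \<and> y = y' \<and> b = z then 1 else 0 else (0::'f))"
    unfolding incidence_mult_def matrix_unit_def by (intro sum.cong refl) auto
  then show "incidence_mult r (matrix_unit x y) (matrix_unit y' z) a b =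
      (if y = y' then matrix_unit x z else (0 :: 'p \<Rightarrow> 'p \<Rightarrow> 'f)) a b"
    using assms by (simp add: sum.delta finite_interval) (auto simp: matrix_unit_def)
qed

text \<open>By antisymmetry the interval from \<open>x\<close> to \<open>x\<close> is
  \<open>{x}\<close>. Consequently two orthogonal idempotents cannot both have entry 1 at the same
  diagonal position.\<close>

lemma incidence_mult_diagonal:
  "x \<in> P \<Longrightarrow> incidence_mult r f g x x = f x x * g x x"
proof -
  assume "x \<in> P"
  then have "{z. (x, z) \<in> r \<and> (z, x) \<in> r} = {x}"
    using rel_refl rel_antisym by blast
  then show ?thesis
    by (simp add: incidence_mult_def)
qed

text \<open>At a pair supporting \<^term>\<open>w\<close> whose interval is as small as possible, the two products
  reduce to a single term.\<close>

lemma one_sided_identities_diagonal: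
  fixes w :: "'p \<Rightarrow> 'p \<Rightarrow> 'f::field"
  assumes w: "w \<in> incidence_algebra r" "w \<noteq> 0"
    and left: "incidence_mult r f w = w" and right: "incidence_mult r w g = w"
  obtains p q where "w p q \<noteq> 0" "f p p = 1" "g q q = 1"
proof -
  define I where "I = (\<lambda>p q. {z. (p, z) \<in> r \<and> (z, q) \<in> r})"
  have finI: "finite (I p q)" for p q
    by (simp add: I_def finite_interval)
  obtain p0 q0 where "w p0 q0 \<noteq> 0"
    using w(2) by (auto simp: fun_eq_iff)
  then obtain p q where pq: "w p q \<noteq> 0"
    and min: "\<And>p' q'. w p' q' \<noteq> 0 \<Longrightarrow> card (I p q) \<le> card (I p' q')"
    using ex_has_least_nat[of "\<lambda>(p, q). w p q \<noteq> 0" "(p0, q0)" "\<lambda>(p, q). card (I p q)"]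
    by auto
  have r: "(p, q) \<in> r" "(p, p) \<in> r" "(q, q) \<in> r"
    using incidence_algebraD[OF w(1) pq] rel_carrier rel_refl by blast+
  then have ends: "p \<in> I p q" "q \<in> I p q"
    by (auto simp: I_def)
  have smaller: "w p' q' = 0" if "I p' q' \<subset> I p q" for p' q'
    using min[of p' q'] psubset_card_mono[OF finI that] by force
  have "w p q = (\<Sum>z\<in>I p q. f p z * w z q)"
    using fun_cong[OF fun_cong[OF left], of p q] by (simp add: incidence_mult_def I_def)
  also have "\<dots> = (\<Sum>z\<in>I p q. if z = p then f p p * w p q else 0)"
  proof (rule sum.cong[OF refl])
    fix z assume z: "z \<in> I p q"
    show "f p z * w z q = (if z = p then f p p * w p q else 0)"
    proof (cases "z = p")
      \<comment> \<open>By antisymmetry the interval from \<open>z\<close> to \<open>q\<close> omits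
        \<open>p\<close>, so it is strictly smaller and \<open>w z q\<close> vanishes by
        minimality.\<close>
      case False
      then have "p \<notin> I z q"
        using z rel_antisym by (auto simp: I_def)
      moreover have "I z q \<subseteq> I p q"
        using z rel_trans by (auto simp: I_def)
      ultimately show ?thesis
        using False ends smaller[of z q] by auto
    qed simp
  qed
  also have "\<dots> = f p p * w p q"
    using ends finI by (simp add: sum.delta)
  finally have "f p p = 1"
    using pq by simp
  have "w p q = (\<Sum>z\<in>I p q. w p z * g z q)"
    using fun_cong[OF fun_cong[OF right], of p q] by (simp add: incidence_mult_def I_def)
  also have "\<dots> = (\<Sum>z\<in>I p q. if z = q then w p q * g q q else 0)"
  proof (rule sum.cong[OF refl])
    fix z assume z: "z \<in> I p q"
    show "w p z * g z q = (if z = q then w p q * g q q else 0)"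
    proof (cases "z = q")
      case False
      then have "q \<notin> I p z"
        using z rel_antisym by (auto simp: I_def)
      moreover have "I p z \<subseteq> I p q"
        using z rel_trans by (auto simp: I_def)
      ultimately show ?thesis
        using False ends smaller[of p z] by auto
    qed simp
  qed
  also have "\<dots> = w p q * g q q"
    using ends finI by (simp add: sum.delta)
  finally have "g q q = 1"
    using pq by simp
  with pq \<open>f p p = 1\<close> show thesis
    by (rule that)
qed

section \<open>Algebra automorphisms and the permutation they induce\<close>

lemma incidence_automorphism_closed:
  "incidence_automorphism P r \<phi> \<Longrightarrow> f \<in> incidence_algebra r \<Longrightarrow> \<phi> f \<in> incidence_algebra r"
  by (auto simp: incidence_automorphism_def dest: bij_betwE)

lemma incidence_automorphism_mult:
  "incidence_automorphism P r \<phi> \<Longrightarrow> f \<in> incidence_algebra r \<Longrightarrow> g \<in> incidence_algebra r \<Longrightarrow>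
    \<phi> (incidence_mult r f g) = incidence_mult r (\<phi> f) (\<phi> g)"
  by (simp add: incidence_automorphism_def)

lemma incidence_automorphism_eq_0_iff:
  assumes \<phi>: "incidence_automorphism P r \<phi>" and f: "f \<in> incidence_algebra r"
  shows "\<phi> f = 0 \<longleftrightarrow> f = 0"
proof -
  have zero: "0 \<in> incidence_algebra r"
    by (simp add: incidence_algebra_def)
  then have "\<phi> (0 + 0) = \<phi> 0 + \<phi> 0"
    using \<phi> unfolding incidence_automorphism_def by blast
  then have "\<phi> 0 = 0"
    by simp
  moreover have "inj_on \<phi> (incidence_algebra r)"
    using \<phi> by (simp add: incidence_automorphism_def bij_betw_def)
  ultimately show ?thesis
    using inj_on_eq_iff[OF _ f zero] by metis
qed

text \<open>An automorphism \<open>\<phi>\<close> induces the map of \<open>P\<close> sending \<open>x\<close> to the unique diagonal position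
  at which the idempotent \<open>\<phi> e\<^sub>x\<^sub>x\<close> is nonzero.\<close>

lemma incidence_automorphism_poset_aut:
  fixes \<phi> :: "('p \<Rightarrow> 'p \<Rightarrow> 'f::field) \<Rightarrow> 'p \<Rightarrow> 'p \<Rightarrow> 'f"
  assumes \<phi>: "incidence_automorphism P r \<phi>"
  obtains \<sigma> where "\<sigma> \<in> poset_aut P r"
    "\<And>x y. (x, y) \<in> r \<Longrightarrow> \<phi> (matrix_unit x y) (\<sigma> x) (\<sigma> y) \<noteq> 0"
proof -
  define e where "e = (\<lambda>x y. \<phi> (matrix_unit x y))"
  have closed: "e x y \<in> incidence_algebra r" if "(x, y) \<in> r" for x y
    unfolding e_def using \<phi> matrix_unit_in_algebra[OF that] by (rule incidence_automorphism_closed)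
  have nonzero: "e x y \<noteq> 0" if "(x, y) \<in> r" for x y
    unfolding e_def incidence_automorphism_eq_0_iff[OF \<phi> matrix_unit_in_algebra[OF that]]
    by (rule matrix_unit_nonzero)
  have mult: "incidence_mult r (e x y) (e y' z) = (if y = y' then e x z else 0)"
    if "(x, y) \<in> r" "(y', z) \<in> r" for x y y' z
  proof -
    have "0 \<in> incidence_algebra r"
      by (simp add: incidence_algebra_def)
    then have "\<phi> 0 = 0"
      using incidence_automorphism_eq_0_iff[OF \<phi>] by blast
    then show ?thesis
      unfolding e_def
      incidence_automorphism_mult[OF \<phi> matrix_unit_in_algebra matrix_unit_in_algebra, OF that, symmetric]
      by (simp add: matrix_unit_mult[OF that])
  qed
  have e_orth: "incidence_mult r (e x x) (e y y) = 0" if "x \<in> P" "y \<in> P" "x \<noteq> y" for x y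
    using that by (simp add: mult rel_refl)
  have pair: "\<exists>p q. e x y p q \<noteq> 0 \<and> e x x p p = 1 \<and> e y y q q = 1" if xy: "(x, y) \<in> r" for x y
  proof -
    have "(x, x) \<in> r" "(y, y) \<in> r"
      using rel_carrier[OF xy] rel_refl by auto
    then have "incidence_mult r (e x x) (e x y) = e x y" "incidence_mult r (e x y) (e y y) = e x y"
      using xy by (simp_all add: mult)
    from one_sided_identities_diagonal[OF closed[OF xy] nonzero[OF xy] this]
    show ?thesis
      by blast
  qed
  \<comment> \<open>A position with entry 1 exists by \<open>pair\<close> at \<open>(x, x)\<close>;
    its uniqueness comes only later, hence the choice. The value \<open>x\<close> outside
    \<open>P\<close> is what \<open>permutes\<close> asks for.\<close>
  define s where "s = (\<lambda>x. if x \<in> P then SOME p. e x x p p = 1 else x)"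
  have s: "e x x (s x) (s x) = 1" if "x \<in> P" for x
  proof -
    have "\<exists>p. e x x p p = 1"
      using pair[OF rel_refl[OF that]] by blast
    from someI_ex[OF this] show ?thesis
      using that by (simp add: s_def)
  qed
  have s_in: "s x \<in> P" if "x \<in> P" for x
    using incidence_algebraD[OF closed[OF rel_refl[OF that]], of "s x" "s x"] s[OF that] rel_carrier
    by auto
  \<comment> \<open>At a shared position the product of the two idempotents would have diagonal
    entry 1, against their orthogonality.\<close>
  have disjoint: "x = y" if "x \<in> P" "y \<in> P" "e x x p p = 1" "e y y p p = 1" for x y p
  proof (rule ccontr)
    assume "x \<noteq> y"
    have "p \<in> P"
      using incidence_algebraD[OF closed[OF rel_refl[OF that(1)]], of p p] that(3) rel_carrier
      by auto
    then show False
      using incidence_mult_diagonal[of p "e x x" "e y y"] e_orth[OF that(1,2) \<open>x \<noteq> y\<close>] that(3,4)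
      by simp
  qed
  have inj: "inj_on s P"
    using disjoint s by (intro inj_onI) metis
  have "s ` P = P"
    using s_in by (intro endo_inj_surj[OF finite_carrier _ inj]) auto
  with inj have perm: "s permutes P"
    by (intro bij_imp_permutes) (simp_all add: bij_betw_def s_def)
  \<comment> \<open>Surjectivity of \<open>s\<close> makes every \<open>p\<close> in
    \<open>P\<close> the chosen position of some \<open>y\<close>, and \<open>disjoint\<close> then
    forces \<open>y = x\<close>. So the positions supplied by \<open>pair\<close> are
    \<open>s x\<close> and \<open>s y\<close>.\<close>
  have unique: "p = s x" if "x \<in> P" "e x x p p = 1" for x p
  proof -
    have "p \<in> P"
      using incidence_algebraD[OF closed[OF rel_refl[OF that(1)]], of p p] that(2) rel_carrier
      by auto
    then obtain y where "y \<in> P" "p = s y"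
      using permutes_image[OF perm] by auto
    then show ?thesis
      using disjoint[OF that(1) \<open>y \<in> P\<close> that(2)] s by simp
  qed
  have nz: "e x y (s x) (s y) \<noteq> 0" if xy: "(x, y) \<in> r" for x y
  proof -
    obtain p q where "e x y p q \<noteq> 0" "e x x p p = 1" "e y y q q = 1"
      using pair[OF xy] by blast
    then show ?thesis
      using unique rel_carrier[OF xy] by blast
  qed
  show thesis
  proof (rule that)
    \<comment> \<open>A nonzero entry of an element of the algebra sits at a pair in
      \<open>r\<close>, so \<open>nz\<close> shows that \<open>s\<close> preserves the
      order.\<close>
    show "s \<in> poset_aut P r"
      using perm incidence_algebraD[OF closed nz] by (rule order_preserving_permutes_poset_aut)
    show "\<phi> (matrix_unit x y) (s x) (s y) \<noteq> 0" if "(x, y) \<in> r" for x y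
      using nz[OF that] by (simp add: e_def)
  qed
qed

section \<open>Algebra automorphisms coming from order automorphisms\<close>

lemma transport_inverse:
  assumes "\<sigma> \<in> poset_aut P r"
  shows "transport \<sigma> (transport (inv_into UNIV \<sigma>) f) = f"
    "transport (inv_into UNIV \<sigma>) (transport \<sigma> f) = f"
  using permutes_inverses[OF poset_aut_permutes[OF assms]] by (simp_all add: transport_def)

lemma transport_in_algebra:
  "\<sigma> \<in> poset_aut P r \<Longrightarrow> f \<in> incidence_algebra r \<Longrightarrow> transport \<sigma> f \<in> incidence_algebra r"
  using poset_aut_rel_iff[of \<sigma>] by (simp add: transport_def incidence_algebra_def)

text \<open>\<open>\<sigma>\<close> maps the interval from \<open>x\<close> to \<open>y\<close>
  bijectively onto that from \<open>\<sigma> x\<close> to \<open>\<sigma> y\<close>, so the defining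
  sum is merely reindexed.\<close>

lemma transport_mult:
  assumes "\<sigma> \<in> poset_aut P r"
  shows "transport \<sigma> (incidence_mult r f g) = incidence_mult r (transport \<sigma> f) (transport \<sigma> g)"
proof (intro ext)
  fix x y
  note perm = poset_aut_permutes[OF assms]
  have "bij_betw \<sigma> {z. (x, z) \<in> r \<and> (z, y) \<in> r} {z. (\<sigma> x, z) \<in> r \<and> (z, \<sigma> y) \<in> r}"
    using poset_aut_rel_iff[OF assms] poset_aut_rel_iff[OF inv_poset_aut[OF assms]]
      permutes_inverses[OF perm]
    by (intro bij_betw_byWitness[where f' = "inv_into UNIV \<sigma>"]) (auto, metis+)
  from sum.reindex_bij_betw[OF this, of "\<lambda>z. f (\<sigma> x) z * g z (\<sigma> y)"]
  show "transport \<sigma> (incidence_mult r f g) x y =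
      incidence_mult r (transport \<sigma> f) (transport \<sigma> g) x y"
    by (simp add: transport_def incidence_mult_def)
qed

lemma incidence_automorphism_transport:
  assumes "\<sigma> \<in> poset_aut P r"
  shows "incidence_automorphism P r (transport \<sigma>)"
proof -
  note perm = poset_aut_permutes[OF assms]
  have "bij_betw (transport \<sigma>) (incidence_algebra r) (incidence_algebra r)"
    using transport_inverse[OF assms] transport_in_algebra assms inv_poset_aut
    by (intro bij_betw_byWitness[where f' = "transport (inv_into UNIV \<sigma>)"]) auto
  moreover have "transport \<sigma> (incidence_one P) = incidence_one P"
    using permutes_in_image[OF perm] permutes_inj[OF perm]
    by (auto simp: transport_def incidence_one_def fun_eq_iff dest: injD)
  ultimately show ?thesis
    by (auto simp: incidence_automorphism_def transport_mult[OF assms])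
      (auto simp: transport_def incidence_scale_def plus_fun_def)
qed

end

section \<open>Induced gradings\<close>

context finite_poset_group
begin

text \<open>The support of an element of the algebra lies in \<open>r\<close>, so homogeneity can be
  read off from the nonzero entries alone.\<close>

lemma induced_grading_iff:
  "g \<in> carrier G \<Longrightarrow> f \<in> induced_grading G r \<theta> g \<longleftrightarrow> f \<in> incidence_algebra r \<and>
    (\<forall>x y. f x y \<noteq> 0 \<longrightarrow> inv (\<theta> x) \<otimes> \<theta> y = g)"
  using incidence_algebraD[of f r] by (auto simp: induced_grading_def)

lemma inv_mult_cancel:
  assumes "a \<in> carrier G" "b \<in> carrier G"
  shows "a \<otimes> (inv a \<otimes> b) = b" "inv a \<otimes> (a \<otimes> b) = b"
  using assms by (simp_all add: m_assoc[symmetric])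

lemma degree_closed:
  "\<theta> \<in> grading_maps G P r \<Longrightarrow> (x, y) \<in> r \<Longrightarrow> inv (\<theta> x) \<otimes> \<theta> y \<in> carrier G"
  using rel_carrier grading_map_closed by simp

lemma degree_mult:
  assumes "\<theta> \<in> grading_maps G P r" "x \<in> P" "y \<in> P" "z \<in> P"
  shows "(inv (\<theta> x) \<otimes> \<theta> y) \<otimes> (inv (\<theta> y) \<otimes> \<theta> z) = inv (\<theta> x) \<otimes> \<theta> z"
proof -
  have "\<theta> x \<in> carrier G" "\<theta> y \<in> carrier G" "\<theta> z \<in> carrier G"
    using assms grading_map_closed by auto
  then show ?thesis
    by (simp add: m_assoc inv_mult_cancel)
qed

lemma induced_grading_subspace:
  assumes "g \<in> carrier G"
  shows "incidence.subspace (induced_grading G r \<theta> g)"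
  using assms unfolding incidence.subspace_def
  by (auto simp: induced_grading_def incidence_algebra_def incidence_scale_def)

text \<open>A nonzero entry of the product at \<open>(x, y)\<close> has a nonzero summand through
  some \<open>z\<close>, with degree \<open>g\<close> at \<open>(x, z)\<close> and \<open>h\<close>
  at \<open>(z, y)\<close>; these degrees telescope.\<close>

lemma induced_grading_mult:
  assumes \<theta>: "\<theta> \<in> grading_maps G P r" and gh: "g \<in> carrier G" "h \<in> carrier G"
    and f1: "f1 \<in> induced_grading G r \<theta> g" and f2: "f2 \<in> induced_grading G r \<theta> h"
  shows "incidence_mult r f1 f2 \<in> induced_grading G r \<theta> (g \<otimes> h)"
proof -
  have "(x, y) \<in> r \<and> inv (\<theta> x) \<otimes> \<theta> y = g \<otimes> h" if "incidence_mult r f1 f2 x y \<noteq> 0" for x y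
  proof -
    obtain z where z: "(x, z) \<in> r" "(z, y) \<in> r" "f1 x z * f2 z y \<noteq> 0"
      using \<open>incidence_mult r f1 f2 x y \<noteq> 0\<close>
      unfolding incidence_mult_def by (elim sum.not_neutral_contains_not_neutral) auto
    then have "inv (\<theta> x) \<otimes> \<theta> z = g" "inv (\<theta> z) \<otimes> \<theta> y = h"
      using f1 f2 gh by (auto simp: induced_grading_iff)
    then show ?thesis
      using degree_mult[OF \<theta>, of x z y] z rel_carrier rel_trans by auto
  qed
  then show ?thesis
    using gh by (auto simp: induced_grading_iff incidence_algebra_def)
qed

text \<open>Every pair in \<open>r\<close> has exactly one degree, so \<open>f\<close> splits into
  its restrictions \<open>part f g\<close> to the pairs of degree \<open>g\<close>. No other
  splitting exists, since at each pair at most one homogeneous component can be nonzero.\<close>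

lemma is_grading_induced_grading:
  assumes \<theta>: "\<theta> \<in> grading_maps G P r"
  shows "is_grading G r (induced_grading G r \<theta> :: 'g \<Rightarrow> ('p \<Rightarrow> 'p \<Rightarrow> 'f::field) set)"
proof -
  let ?\<Gamma> = "induced_grading G r \<theta> :: 'g \<Rightarrow> ('p \<Rightarrow> 'p \<Rightarrow> 'f) set"
  define part where "part = (\<lambda>f :: 'p \<Rightarrow> 'p \<Rightarrow> 'f. \<lambda>g\<in>carrier G. \<lambda>x y.
    if inv (\<theta> x) \<otimes> \<theta> y = g then f x y else 0)"
  have sum_apply: "(\<Sum>g | g \<in> carrier G \<and> a g \<noteq> 0. a g) x y = (\<Sum>g\<in>carrier G. a g x y)"
    for a :: "'g \<Rightarrow> 'p \<Rightarrow> 'p \<Rightarrow> 'f" and x y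
    unfolding sum_fun_apply2 using finite_group by (intro sum.mono_neutral_left) auto
  have decomposition: "\<exists>!a. a \<in> Pi\<^sub>E (carrier G) ?\<Gamma> \<and> finite {g \<in> carrier G. a g \<noteq> 0} \<and>
      f = (\<Sum>g | g \<in> carrier G \<and> a g \<noteq> 0. a g)"
    if f: "f \<in> incidence_algebra r" for f
  proof (rule ex1I[of _ "part f"], intro conjI)
    show "part f \<in> Pi\<^sub>E (carrier G) ?\<Gamma>"
      using f by (auto simp: part_def induced_grading_iff incidence_algebra_def)
    show "finite {g \<in> carrier G. part f g \<noteq> 0}"
      using finite_group by simp
    show "f = (\<Sum>g | g \<in> carrier G \<and> part f g \<noteq> 0. part f g)"
    proof (intro ext)
      fix x y
      have "(\<Sum>g\<in>carrier G. part f g x y) = f x y"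
        using incidence_algebraD[OF f, of x y] degree_closed[OF \<theta>, of x y] finite_group
        by (cases "f x y = 0") (simp_all add: part_def sum.delta')
      then show "f x y = (\<Sum>g | g \<in> carrier G \<and> part f g \<noteq> 0. part f g) x y"
        by (simp only: sum_apply)
    qed
  next
    fix a assume a: "a \<in> Pi\<^sub>E (carrier G) ?\<Gamma> \<and> finite {g \<in> carrier G. a g \<noteq> 0} \<and>
      f = (\<Sum>g | g \<in> carrier G \<and> a g \<noteq> 0. a g)"
    show "a = part f"
    proof (rule extensionalityI[of _ "carrier G"])
      fix g assume g: "g \<in> carrier G"
      have comp: "a h x y \<noteq> 0 \<Longrightarrow> (x, y) \<in> r \<and> inv (\<theta> x) \<otimes> \<theta> y = h" if "h \<in> carrier G" for h x y
        using a that incidence_algebraD by (auto simp: induced_grading_iff dest!: PiE_mem)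
      show "a g = part f g"
      proof (intro ext)
        fix x y
        have "f x y = (\<Sum>h\<in>carrier G. a h x y)"
          using a sum_apply by metis
        \<comment> \<open>This equality is conditional: at pairs of degree \<open>g\<close> the
          other summands vanish. At all remaining pairs both \<open>a g\<close> and
          \<open>part f g\<close> are zero, the former by \<open>comp\<close>.\<close>
        also have "\<dots> = a g x y" if "inv (\<theta> x) \<otimes> \<theta> y = g"
          using g that comp finite_group by (subst sum.remove[OF _ g]) (auto intro!: sum.neutral)
        finally show "a g x y = part f g x y"
          using g comp[OF g, of x y] by (auto simp: part_def)
      qed
    qed (use a in \<open>auto simp: part_def PiE_iff\<close>)
  qed
  have "?\<Gamma> \<in> extensional (carrier G)"
    by (simp add: induced_grading_def)
  then show ?thesis
    unfolding is_grading_def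
    by (intro conjI ballI decomposition induced_grading_subspace induced_grading_mult[OF \<theta>])
      (auto simp: induced_grading_iff)
qed

lemma elementary_gradings_eq:
  "elementary_gradings G P r =
    (induced_grading G r :: _ \<Rightarrow> 'g \<Rightarrow> ('p \<Rightarrow> 'p \<Rightarrow> 'f::field) set) ` grading_maps G P r"
  by (auto simp: elementary_gradings_def is_grading_induced_grading)

section \<open>Equivalent maps and isomorphic gradings\<close>

lemma degree_left_mult:
  assumes "c \<in> carrier G" "a \<in> carrier G" "b \<in> carrier G"
  shows "inv (c \<otimes> a) \<otimes> (c \<otimes> b) = inv a \<otimes> b"
  using assms by (simp add: inv_mult_group m_assoc inv_mult_cancel)

text \<open>Expresses the equivalence through degrees, which is all a graded isomorphism sees. A
  tuple takes one value along a comparable pair and cancels from the degree; conversely, equal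
  degrees make the quotient \<open>t\<close> of the two maps constant on components, and its values
  form the tuple.\<close>

lemma grading_map_rel_iff_degrees:
  assumes \<theta>: "\<theta> \<in> grading_maps G P r" and \<mu>: "\<mu> \<in> grading_maps G P r"
  shows "(\<theta>, \<mu>) \<in> grading_map_rel G P r \<longleftrightarrow>
    (\<exists>\<sigma>\<in>poset_aut P r. \<forall>(x, y)\<in>r. inv (\<theta> (\<sigma> x)) \<otimes> \<theta> (\<sigma> y) = inv (\<mu> x) \<otimes> \<mu> y)"
proof
  assume "(\<theta>, \<mu>) \<in> grading_map_rel G P r"
  then obtain h \<sigma> where h: "h \<in> component_tuples G P r" and \<sigma>: "\<sigma> \<in> poset_aut P r"
    and eq: "\<theta> = relabel (h, \<sigma>) \<mu>"
    by (auto simp: grading_map_rel_def relabel_def)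
  have "inv (\<theta> (\<sigma> x)) \<otimes> \<theta> (\<sigma> y) = inv (\<mu> x) \<otimes> \<mu> y" if xy: "(x, y) \<in> r" for x y
  proof -
    have \<sigma>r: "(\<sigma> x, \<sigma> y) \<in> r"
      using poset_aut_rel_iff[OF \<sigma>] xy by simp
    have "\<theta> (\<sigma> z) = h (component P r (\<sigma> z)) \<otimes> \<mu> z" if "\<sigma> z \<in> P" for z
      using that permutes_inverses[OF poset_aut_permutes[OF \<sigma>]] by (simp add: eq relabel_apply)
    then show ?thesis
      using \<sigma>r xy h rel_carrier component_rel[OF \<sigma>r]
      by (simp add: degree_left_mult component_tuples_closed component_in_components
          grading_map_closed[OF \<mu>])
  qed
  with \<sigma> show "\<exists>\<sigma>\<in>poset_aut P r. \<forall>(x, y)\<in>r. inv (\<theta> (\<sigma> x)) \<otimes> \<theta> (\<sigma> y) = inv (\<mu> x) \<otimes> \<mu> y"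
    by blast
next
  assume "\<exists>\<sigma>\<in>poset_aut P r. \<forall>(x, y)\<in>r. inv (\<theta> (\<sigma> x)) \<otimes> \<theta> (\<sigma> y) = inv (\<mu> x) \<otimes> \<mu> y"
  then obtain \<sigma> where \<sigma>: "\<sigma> \<in> poset_aut P r"
    and deg: "\<And>x y. (x, y) \<in> r \<Longrightarrow> inv (\<theta> (\<sigma> x)) \<otimes> \<theta> (\<sigma> y) = inv (\<mu> x) \<otimes> \<mu> y"
    by blast
  note perm = poset_aut_permutes[OF \<sigma>]
  let ?\<tau> = "inv_into UNIV \<sigma>"
  \<comment> \<open>If \<open>\<theta>\<close> is to arise from \<open>\<mu>\<close> through
    \<open>(h, \<sigma>)\<close>, then \<open>t x\<close> must be the entry of \<open>h\<close> at
    the component of \<open>x\<close>.\<close>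
  define t where "t = (\<lambda>x. \<theta> x \<otimes> inv (\<mu> (?\<tau> x)))"
  have t_closed: "t x \<in> carrier G" if "x \<in> P" for x
    using that \<theta> \<mu> by (simp add: t_def grading_map_closed inv_poset_aut_closed[OF \<sigma>])
  have t_rel: "t x = t y" if "(x, y) \<in> r" for x y
  proof -
    have "(?\<tau> x, ?\<tau> y) \<in> r"
      using that poset_aut_rel_iff[OF inv_poset_aut[OF \<sigma>]] by simp
    from deg[OF this] have eq: "inv (\<theta> x) \<otimes> \<theta> y = inv (\<mu> (?\<tau> x)) \<otimes> \<mu> (?\<tau> y)"
      using permutes_inverses[OF perm] by simp
    have closed: "\<theta> x \<in> carrier G" "\<theta> y \<in> carrier G" "\<mu> (?\<tau> x) \<in> carrier G" "\<mu> (?\<tau> y) \<in> carrier G"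
      using rel_carrier[OF that] \<theta> \<mu> by (simp_all add: grading_map_closed inv_poset_aut_closed[OF \<sigma>])
    have "\<theta> y = \<theta> x \<otimes> (inv (\<theta> x) \<otimes> \<theta> y)"
      using closed by (simp add: m_assoc[symmetric])
    also have "\<dots> = t x \<otimes> \<mu> (?\<tau> y)"
      using closed by (simp add: eq t_def m_assoc)
    finally show ?thesis
      using closed by (simp add: t_def m_assoc)
  qed
  have t_component: "t x = t y" if "x \<in> P" "y \<in> component P r x" for x y
  proof -
    have "(x, y) \<in> (r \<union> r\<inverse>)\<^sup>*"
      using that(2) by (simp add: component_def connected_rel_def)
    then show ?thesis
      by (induction rule: rtrancl_induct) (auto dest: t_rel)
  qed
  \<comment> \<open>By \<open>t_component\<close> the chosen representative of \<open>C\<close> does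
    not affect the value.\<close>
  define h where "h = (\<lambda>C\<in>components P r. t (SOME x. x \<in> C))"
  have some: "(SOME y. y \<in> component P r x) \<in> component P r x" if "x \<in> P" for x
    using self_in_component[OF that] by (rule someI)
  then have h_component: "h (component P r x) = t x" if "x \<in> P" for x
    using that t_component[OF that some[OF that]] by (simp add: h_def component_in_components)
  have h: "h \<in> component_tuples G P r"
    using some component_subset t_closed
    by (auto simp: h_def restrict_component_tuples elim!: componentsE)
  have "\<theta> = relabel (h, \<sigma>) \<mu>"
  proof (rule grading_map_eqI[OF \<theta> relabel_closed[OF h \<sigma> \<mu>]])
    fix x assume "x \<in> P"
    then show "\<theta> x = relabel (h, \<sigma>) \<mu> x"
      using \<theta> \<mu> by (simp add: relabel_apply h_component t_def m_assoc grading_map_closed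
          inv_poset_aut_closed[OF \<sigma>])
  qed
  then show "(\<theta>, \<mu>) \<in> grading_map_rel G P r"
    using \<theta> \<mu> h \<sigma> by (auto simp: grading_map_rel_def relabel_def)
qed

text \<open>Forwards, the image of a matrix unit keeps its degree and is nonzero at
  \<open>(\<sigma> x, \<sigma> y)\<close>, so the degrees of \<open>\<theta>\<close> and
  \<open>\<mu>\<close> match along \<open>\<sigma>\<close>. Backwards,
  \<open>transport \<sigma>\<close> is a graded isomorphism.\<close>

lemma graded_isomorphic_iff:
  assumes \<theta>: "\<theta> \<in> grading_maps G P r" and \<mu>: "\<mu> \<in> grading_maps G P r"
  shows "graded_isomorphic G P r (induced_grading G r \<theta> :: 'g \<Rightarrow> ('p \<Rightarrow> 'p \<Rightarrow> 'f::field) set)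
      (induced_grading G r \<mu>) \<longleftrightarrow> (\<theta>, \<mu>) \<in> grading_map_rel G P r"
proof
  assume "graded_isomorphic G P r (induced_grading G r \<theta> :: 'g \<Rightarrow> ('p \<Rightarrow> 'p \<Rightarrow> 'f) set)
      (induced_grading G r \<mu>)"
  then obtain \<phi> :: "('p \<Rightarrow> 'p \<Rightarrow> 'f) \<Rightarrow> 'p \<Rightarrow> 'p \<Rightarrow> 'f"
    where \<phi>: "incidence_automorphism P r \<phi>"
      and graded: "\<And>g. g \<in> carrier G \<Longrightarrow> \<phi> ` induced_grading G r \<theta> g = induced_grading G r \<mu> g"
    unfolding graded_isomorphic_def by blast
  obtain \<sigma> where \<sigma>: "\<sigma> \<in> poset_aut P r"
    and nz: "\<And>x y. (x, y) \<in> r \<Longrightarrow> \<phi> (matrix_unit x y) (\<sigma> x) (\<sigma> y) \<noteq> 0"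
    by (rule incidence_automorphism_poset_aut[OF \<phi>]) (rule that)
  have "inv (\<mu> (\<sigma> x)) \<otimes> \<mu> (\<sigma> y) = inv (\<theta> x) \<otimes> \<theta> y" if "(x, y) \<in> r" for x y
  proof -
    let ?g = "inv (\<theta> x) \<otimes> \<theta> y"
    have g: "?g \<in> carrier G"
      using \<theta> that by (rule degree_closed)
    have "matrix_unit x y \<in> induced_grading G r \<theta> ?g"
      using g matrix_unit_in_algebra[OF that] by (auto simp: induced_grading_iff matrix_unit_def)
    then have "\<phi> (matrix_unit x y) \<in> induced_grading G r \<mu> ?g"
      using graded[OF g] by blast
    then show ?thesis
      using g nz[OF that] by (simp add: induced_grading_iff)
  qed
  \<comment> \<open>Here \<open>\<sigma>\<close> is applied to the arguments of
    \<open>\<mu>\<close>, so the degree criterion yields the reversed pair; symmetry restores the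
    order.\<close>
  then have "(\<mu>, \<theta>) \<in> grading_map_rel G P r"
    using grading_map_rel_iff_degrees[OF \<mu> \<theta>] \<sigma> by blast
  then show "(\<theta>, \<mu>) \<in> grading_map_rel G P r"
    using equiv_grading_map_rel by (auto simp: equiv_def dest: symD)
next
  assume "(\<theta>, \<mu>) \<in> grading_map_rel G P r"
  then obtain \<sigma> where \<sigma>: "\<sigma> \<in> poset_aut P r"
    and deg: "\<And>x y. (x, y) \<in> r \<Longrightarrow> inv (\<theta> (\<sigma> x)) \<otimes> \<theta> (\<sigma> y) = inv (\<mu> x) \<otimes> \<mu> y"
    using grading_map_rel_iff_degrees[OF \<theta> \<mu>] by blast
  have "transport \<sigma> ` induced_grading G r \<theta> g =
      (induced_grading G r \<mu> g :: ('p \<Rightarrow> 'p \<Rightarrow> 'f) set)" if g: "g \<in> carrier G" for g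
  proof (intro equalityI subsetI)
    fix f :: "'p \<Rightarrow> 'p \<Rightarrow> 'f"
    assume "f \<in> transport \<sigma> ` induced_grading G r \<theta> g"
    then obtain f' where f': "f = transport \<sigma> f'" "f' \<in> induced_grading G r \<theta> g"
      by blast
    then have "f \<in> incidence_algebra r"
      using g transport_in_algebra[OF \<sigma>] by (auto simp: induced_grading_iff)
    moreover have "inv (\<mu> x) \<otimes> \<mu> y = g" if "f x y \<noteq> 0" for x y
      using deg[OF incidence_algebraD[OF calculation that]] that f' g
      by (auto simp: induced_grading_iff transport_def)
    ultimately show "f \<in> induced_grading G r \<mu> g"
      using g by (auto simp: induced_grading_iff)
  next
    fix f :: "'p \<Rightarrow> 'p \<Rightarrow> 'f"
    assume f: "f \<in> induced_grading G r \<mu> g"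
    let ?f = "transport (inv_into UNIV \<sigma>) f"
    have f': "?f \<in> incidence_algebra r"
      using f g transport_in_algebra[OF inv_poset_aut[OF \<sigma>]] by (auto simp: induced_grading_iff)
    moreover have "inv (\<theta> x) \<otimes> \<theta> y = g" if "?f x y \<noteq> 0" for x y
    proof -
      let ?x = "inv_into UNIV \<sigma> x" and ?y = "inv_into UNIV \<sigma> y"
      have nz: "f ?x ?y \<noteq> 0"
        using that by (simp add: transport_def)
      then have "(?x, ?y) \<in> r" "inv (\<mu> ?x) \<otimes> \<mu> ?y = g"
        using f g incidence_algebraD by (auto simp: induced_grading_iff)
      then show ?thesis
        using deg[of ?x ?y] permutes_inverses[OF poset_aut_permutes[OF \<sigma>]] by simp
    qed
    ultimately have "?f \<in> induced_grading G r \<theta> g"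
      using g by (auto simp: induced_grading_iff)
    then show "f \<in> transport \<sigma> ` induced_grading G r \<theta> g"
      using transport_inverse(1)[OF \<sigma>, of f] by (metis image_eqI)
  qed
  then show "graded_isomorphic G P r (induced_grading G r \<theta> :: 'g \<Rightarrow> ('p \<Rightarrow> 'p \<Rightarrow> 'f) set)
      (induced_grading G r \<mu>)"
    unfolding graded_isomorphic_def using incidence_automorphism_transport[OF \<sigma>] by blast
qed

end

section \<open>From classes of maps to classes of gradings\<close>

theorem corollary3p9:
  fixes P :: "'p set" and r :: "'p rel"
    and G :: "('g, 'm) monoid_scheme"
    and k n\<^sub>G :: nat
  assumes "finite P" and "partial_order_on P r"
    and "card (components P r) = k"
    and "group G" and "finite (carrier G)"
    and "n\<^sub>G = card ((elementary_gradings G P r :: ('g \<Rightarrow> ('p \<Rightarrow> 'p \<Rightarrow> 'f::field) set) set)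
                    // elementary_iso_rel G P r)"
  shows "real n\<^sub>G =
           1 / (real (card (carrier G)) ^ k * real (card (poset_aut P r))) *
           (\<Sum>(h, \<sigma>) \<in> component_tuples G P r \<times> poset_aut P r. real (card (fixed_maps G P r h \<sigma>)))
         \<and> n\<^sub>G = card (grading_maps G P r // grading_map_rel G P r)"
proof -
  interpret finite_poset_group P r G
    using assms by (simp add: finite_poset_group_def finite_poset_def finite_poset_group_axioms_def)
  let ?S = "\<Sum>(h, \<sigma>) \<in> component_tuples G P r \<times> poset_aut P r. card (fixed_maps G P r h \<sigma>)"
  \<comment> \<open>The set of elementary gradings is the image of the grading maps under
    \<open>induced_grading G r\<close>, and graded isomorphism pulls back along it to
    \<open>grading_map_rel\<close>.\<close>
  have n: "n\<^sub>G = card (grading_maps G P r // grading_map_rel G P r)"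
    unfolding assms(6) elementary_gradings_eq
    by (rule card_quotient_image[OF equiv_grading_map_rel])
      (auto simp: elementary_iso_rel_def elementary_gradings_eq graded_isomorphic_iff)
  have "card (carrier G) \<noteq> 0" "card (poset_aut P r) \<noteq> 0"
    using finite_group finite_poset_aut id_poset_aut one_closed by auto
  moreover have "real n\<^sub>G * (real (card (carrier G)) ^ k * real (card (poset_aut P r))) = real ?S"
    using arg_cong[OF card_classes_mult_order, of real] by (simp add: n assms(3))
  ultimately have "real n\<^sub>G = 1 / (real (card (carrier G)) ^ k * real (card (poset_aut P r))) * real ?S"
    by (simp add: field_simps)
  then show ?thesis
    using n by (simp add: case_prod_beta')
qed

end
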